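(* Let $d\ge1$ and $n,a_1,\ldots,a_d,m$ be positive integers. If $(n;a_1,\ldots,a_d)\xrightarrow{\textsc{ad}} m$, then $(n;a_1,\ldots,a_d)\xrightarrow{\textsc{im}} m$.
   Context: Admissible division. Let $\Delta_{a-1}=\{x\in\mathbb{R}^a_{\ge0}:\sum_i x_i=1\}$ and $\mathcal{P}=\prod_{t=1}^d\Delta_{a_t-1}$; $P=(P^1,\ldots,P^d)\in\mathcal{P}$ represents a division of $d$ cakes (copies of $[0,1]$), cake $t$ cut into $a_t$ consecutive slices of lengths $P^t_1,\ldots,P^t_{a_t}$. Let $\mathcal{J}=[a_1]\times\cdots\times[a_d]$; $\vec j=(j_1,\ldots,j_d)$ denotes the $d$-tuple consisting of slice $j_t$ of cake $t$. An instance with $n$ agents consists of, for each agent $i$, a map $L^i$ assigning to every $P\in\mathcal{P}$ a set $L^i(P)\subseteq\mathcal{J}$ such that (i) for each $\vec j$ the set $\{P:\vec j\in L^i(P)\}$ is closed, and (ii) for every $P$ there is $\vec j\in L^i(P)$ with $P^t_{j_t}>0$ for all $t$. $\nu^D(P)$ is the largest size of a set $Q$ of agents with a map $\phi:Q\to\mathcal{J}$ such that $\phi(q)\in L^q(P)$ for all $q$ and distinct $q,q'$ get vectors differing in every coordinate. $(n;a_1,\ldots,a_d)\xrightarrow{\textsc{ad}} m$ means that for every instance with $n$ agents some $P$ has $\nu^D(P)\ge m$. $d$-intervals. Let $C_1,\ldots,C_d$ be disjoint copies of $[0,1]$. A $d$-interval is a union of $d$ open intervals, one in each $C_t$. We write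 $(n;a_1,\ldots,a_d)\xrightarrow{\textsc{im}} m$ if for any $n$ finite families $\mathcal{F}_1,\ldots,\mathcal{F}_n$ of $d$-intervals such that for each $i$ the family $\mathcal{F}_i$ cannot be covered by any choice of $a_t-1$ points on each $C_t$ ($t\in[d]$) (i.e., no such point set meets every member of $\mathcal{F}_i$), there is a rainbow matching of size $m$: $m$ pairwise disjoint $d$-intervals belonging to $m$ distinct families $\mathcal{F}_i$, at most one from each family. *)

theory Defs
  imports "HOL-Homology.Simplices"
begin

text \<open>
  Cakes are numbered \<open>0, \<dots>, d - 1\<close>, the slices of cake \<open>t\<close> are numbered \<open>0, \<dots>, a t - 1\<close>,
  and agents are numbered \<open>0, \<dots>, n - 1\<close>.
\<close>

text \<open>
  \<^term>\<open>standard_simplex (k - 1)\<close> is the set of points of $\Delta_{k-1} \subseteq \mathbb{R}^k$,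
  extended by zero to sequences. The topology on divisions is the subspace topology of the
  product topology on \<^typ>\<open>nat \<Rightarrow> nat \<Rightarrow> real\<close>; as all coordinates other than the slice lengths
  are constant on the set below, it is the Euclidean one.
\<close>

definition divisions :: "nat \<Rightarrow> (nat \<Rightarrow> nat) \<Rightarrow> (nat \<Rightarrow> nat \<Rightarrow> real) set" where
  "divisions d a = (\<Pi>\<^sub>E t\<in>{..<d}. standard_simplex (a t - 1))"

definition slice_tuples :: "nat \<Rightarrow> (nat \<Rightarrow> nat) \<Rightarrow> (nat \<Rightarrow> nat) set" where
  "slice_tuples d a = (\<Pi>\<^sub>E t\<in>{..<d}. {..<a t})"

definition preference ::
    "nat \<Rightarrow> (nat \<Rightarrow> nat) \<Rightarrow> ((nat \<Rightarrow> nat \<Rightarrow> real) \<Rightarrow> (nat \<Rightarrow> nat) set) \<Rightarrow> bool" where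
  "preference d a L \<longleftrightarrow>
     (\<forall>P\<in>divisions d a. L P \<subseteq> slice_tuples d a) \<and>
     (\<forall>j\<in>slice_tuples d a. closedin (top_of_set (divisions d a)) {P \<in> divisions d a. j \<in> L P}) \<and>
     (\<forall>P\<in>divisions d a. \<exists>j\<in>L P. \<forall>t<d. P t (j t) > 0)"

definition admissible_assignment ::
    "nat \<Rightarrow> (nat \<Rightarrow> nat) \<Rightarrow> nat \<Rightarrow> (nat \<Rightarrow> (nat \<Rightarrow> nat \<Rightarrow> real) \<Rightarrow> (nat \<Rightarrow> nat) set)
     \<Rightarrow> (nat \<Rightarrow> nat \<Rightarrow> real) \<Rightarrow> nat set \<Rightarrow> (nat \<Rightarrow> nat \<Rightarrow> nat) \<Rightarrow> bool" where
  "admissible_assignment d a n L P Q \<phi> \<longleftrightarrow>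
     Q \<subseteq> {..<n} \<and> \<phi> \<in> Q \<rightarrow> slice_tuples d a \<and>
     (\<forall>q\<in>Q. \<phi> q \<in> L q P) \<and>
     (\<forall>q\<in>Q. \<forall>q'\<in>Q. q \<noteq> q' \<longrightarrow> (\<forall>t<d. \<phi> q t \<noteq> \<phi> q' t))"

text \<open>The maximum is over a nonempty set (take \<open>Q = {}\<close>) of numbers bounded by \<open>n\<close>.\<close>

definition nu_D ::
    "nat \<Rightarrow> (nat \<Rightarrow> nat) \<Rightarrow> nat \<Rightarrow> (nat \<Rightarrow> (nat \<Rightarrow> nat \<Rightarrow> real) \<Rightarrow> (nat \<Rightarrow> nat) set)
     \<Rightarrow> (nat \<Rightarrow> nat \<Rightarrow> real) \<Rightarrow> nat" where
  "nu_D d a n L P = Max {card Q | Q. \<exists>\<phi>. admissible_assignment d a n L P Q \<phi>}"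

definition ad_arrow :: "nat \<Rightarrow> nat \<Rightarrow> (nat \<Rightarrow> nat) \<Rightarrow> nat \<Rightarrow> bool" where
  "ad_arrow n d a m \<longleftrightarrow>
     (\<forall>L. (\<forall>i<n. preference d a (L i)) \<longrightarrow> (\<exists>P\<in>divisions d a. nu_D d a n L P \<ge> m))"

text \<open>
  The point \<open>x\<close> of the copy \<open>C\<^sub>t\<close> of \<open>[0,1]\<close> is the pair \<open>(t, x)\<close>. Intervals are nonempty.
\<close>

definition d_interval :: "nat \<Rightarrow> (nat \<times> real) set \<Rightarrow> bool" where
  "d_interval d f \<longleftrightarrow>
     (\<exists>u v. (\<forall>t<d. 0 \<le> u t \<and> u t < v t \<and> v t \<le> 1) \<and> f = (SIGMA t:{..<d}. {u t<..<v t}))"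

text \<open>Finiteness has to be required explicitly, since infinite sets have cardinality \<open>0\<close>.\<close>

definition coverable :: "nat \<Rightarrow> (nat \<Rightarrow> nat) \<Rightarrow> (nat \<times> real) set set \<Rightarrow> bool" where
  "coverable d a \<F> \<longleftrightarrow>
     (\<exists>X. (\<forall>t<d. X t \<subseteq> {0..1} \<and> finite (X t) \<and> card (X t) = a t - 1) \<and>
          (\<forall>f\<in>\<F>. f \<inter> (SIGMA t:{..<d}. X t) \<noteq> {}))"

definition rainbow_matching ::
    "nat \<Rightarrow> (nat \<Rightarrow> (nat \<times> real) set set) \<Rightarrow> nat set \<Rightarrow> (nat \<Rightarrow> (nat \<times> real) set) \<Rightarrow> bool" where
  "rainbow_matching n \<F> Q f \<longleftrightarrow>
     Q \<subseteq> {..<n} \<and> (\<forall>q\<in>Q. f q \<in> \<F> q) \<and> (\<forall>q\<in>Q. \<forall>q'\<in>Q. q \<noteq> q' \<longrightarrow> disjnt (f q) (f q'))"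

definition im_arrow :: "nat \<Rightarrow> nat \<Rightarrow> (nat \<Rightarrow> nat) \<Rightarrow> nat \<Rightarrow> bool" where
  "im_arrow n d a m \<longleftrightarrow>
     (\<forall>\<F>. (\<forall>i<n. finite (\<F> i) \<and> (\<forall>f\<in>\<F> i. d_interval d f) \<and> \<not> coverable d a (\<F> i)) \<longrightarrow>
          (\<exists>Q f. rainbow_matching n \<F> Q f \<and> card Q = m))"

end

theory Submission
  imports Defs
begin

text \<open>
  Given the families \<open>\<F>\<^sub>i\<close>, let agent \<open>i\<close> accept, in the division \<open>P\<close>, every tuple of slices
  whose interiors contain some member of \<open>\<F>\<^sub>i\<close>. Since \<open>\<F>\<^sub>i\<close> is finite this is a closed condition
  on \<open>P\<close>, and since the cut points of \<open>P\<close> do not cover \<open>\<F>\<^sub>i\<close>, some member avoids all of them and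
  so lies inside a tuple of slices, necessarily of positive length. Tuples of slices differing in
  every coordinate have disjoint interiors, so an admissible assignment yields a rainbow matching.
\<close>

text \<open>Slice \<open>k\<close> of cake \<open>t\<close> runs from the cut point of index
  \<open>k\<close> to that of index \<open>Suc k\<close>. For a division, indices \<open>0\<close>
  and \<open>a t\<close> give the ends of the cake, so only the \<open>a t - 1\<close> indices in
  between are genuine cuts.\<close>

definition cut_point :: "(nat \<Rightarrow> nat \<Rightarrow> real) \<Rightarrow> nat \<Rightarrow> nat \<Rightarrow> real" where
  "cut_point P t k = (\<Sum>i<k. P t i)"

definition slice_box :: "nat \<Rightarrow> (nat \<Rightarrow> nat \<Rightarrow> real) \<Rightarrow> (nat \<Rightarrow> nat) \<Rightarrow> (nat \<times> real) set" where
  "slice_box d P j = (SIGMA t:{..<d}. {cut_point P t (j t)<..<cut_point P t (Suc (j t))})"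

definition interval_preference ::
    "nat \<Rightarrow> (nat \<Rightarrow> nat) \<Rightarrow> (nat \<times> real) set set \<Rightarrow> (nat \<Rightarrow> nat \<Rightarrow> real) \<Rightarrow> (nat \<Rightarrow> nat) set" where
  "interval_preference d a \<F> P = {j \<in> slice_tuples d a. \<exists>f\<in>\<F>. f \<subseteq> slice_box d P j}"

lemma cut_point_0 [simp]: "cut_point P t 0 = 0"
  by (simp add: cut_point_def)

lemma cut_point_Suc: "cut_point P t (Suc k) = cut_point P t k + P t k"
  by (simp add: cut_point_def)

lemma divisions_simplex: "P \<in> divisions d a \<Longrightarrow> t < d \<Longrightarrow> P t \<in> standard_simplex (a t - 1)"
  by (auto simp: divisions_def)

lemma cut_point_mono:
  assumes "P \<in> divisions d a" "t < d" "k \<le> l"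
  shows "cut_point P t k \<le> cut_point P t l"
  unfolding cut_point_def using divisions_simplex[OF assms(1,2)] assms(3)
  by (intro sum_mono2) (auto simp: standard_simplex_def)

lemma cut_point_last:
  assumes "P \<in> divisions d a" "t < d" "a t \<ge> 1"
  shows "cut_point P t (a t) = 1"
proof -
  \<comment> \<open>For \<open>a t = 0\<close> truncated subtraction would make the right-hand side
    \<open>{0}\<close>.\<close>
  have "{..<a t} = {..a t - 1}"
    using assms(3) by auto
  then show ?thesis
    using divisions_simplex[OF assms(1,2)] by (simp add: cut_point_def standard_simplex_def)
qed

lemma continuous_on_cut_point: "continuous_on S (\<lambda>P. cut_point P t k)"
  unfolding cut_point_def
proof (rule continuous_on_sum)
  fix i
  show "continuous_on S (\<lambda>P. P t i)"
    using continuous_on_product_then_coordinatewise[OF continuous_on_product_coordinates]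
    by (rule continuous_on_subset) simp
qed

text \<open>Containment of nonempty open intervals amounts to weak inequalities between endpoints.
  Their weakness is what makes acceptance a closed condition on \<open>P\<close>.\<close>

lemma Sigma_subset_slice_box_iff:
  assumes "\<And>t. t < d \<Longrightarrow> u t < v t"
  shows "(SIGMA t:{..<d}. {u t<..<v t}) \<subseteq> slice_box d P j \<longleftrightarrow>
    (\<forall>t<d. cut_point P t (j t) \<le> u t \<and> v t \<le> cut_point P t (Suc (j t)))"
proof -
  have "(SIGMA t:{..<d}. {u t<..<v t}) \<subseteq> slice_box d P j \<longleftrightarrow>
    (\<forall>t<d. {u t<..<v t} \<subseteq> {cut_point P t (j t)<..<cut_point P t (Suc (j t))})"
    unfolding slice_box_def by blast
  also have "\<dots> \<longleftrightarrow> (\<forall>t<d. cut_point P t (j t) \<le> u t \<and> v t \<le> cut_point P t (Suc (j t)))"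
    using assms by (auto simp: greaterThanLessThan_subseteq_greaterThanLessThan)
  finally show ?thesis .
qed

lemma closedin_subset_slice_box:
  assumes "d_interval d f"
  shows "closedin (top_of_set S) {P \<in> S. f \<subseteq> slice_box d P j}"
proof -
  from assms obtain u v where uv: "\<And>t. t < d \<Longrightarrow> u t < v t"
    and f: "f = (SIGMA t:{..<d}. {u t<..<v t})"
    unfolding d_interval_def by blast
  let ?C = "\<lambda>t. {P. cut_point P t (j t) \<le> u t} \<inter> {P. v t \<le> cut_point P t (Suc (j t))}"
  have "closed (?C t)" for t
    by (intro closed_Int closed_Collect_le continuous_on_cut_point continuous_on_const)
  then have "closed (\<Inter>t<d. ?C t)"
    by blast
  moreover have "{P \<in> S. f \<subseteq> slice_box d P j} = S \<inter> (\<Inter>t<d. ?C t)"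
    by (auto simp: f Sigma_subset_slice_box_iff uv)
  ultimately show ?thesis
    by (simp add: closedin_closed_Int)
qed

lemma disjnt_slice_box:
  assumes "P \<in> divisions d a" and "\<And>t. t < d \<Longrightarrow> j t \<noteq> j' t"
  shows "disjnt (slice_box d P j) (slice_box d P j')"
  unfolding disjnt_iff
proof (intro allI notI, elim conjE)
  fix p
  assume "p \<in> slice_box d P j" "p \<in> slice_box d P j'"
  then obtain t x where "t < d"
    and x: "cut_point P t (j t) < x" "x < cut_point P t (Suc (j t))" "cut_point P t (j' t) < x" "x < cut_point P t (Suc (j' t))"
    unfolding slice_box_def by auto
  \<comment> \<open>On cake \<open>t\<close>, one of the two slices ends no later than the other
    begins.\<close>
  have "Suc (j t) \<le> j' t \<or> Suc (j' t) \<le> j t"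
    using assms(2)[OF \<open>t < d\<close>] by linarith
  then show False
  proof
    assume "Suc (j t) \<le> j' t"
    from cut_point_mono[OF assms(1) \<open>t < d\<close> this] x show False
      by linarith
  next
    assume "Suc (j' t) \<le> j t"
    from cut_point_mono[OF assms(1) \<open>t < d\<close> this] x show False
      by linarith
  qed
qed

text \<open>Take the slice starting at the last cut point not beyond \<open>u\<close>. The next cut
  point exceeds \<open>u\<close> and is not in the interval, so it is at least \<open>v\<close>; if
  there is no further cut, the slice ends at 1.\<close>

lemma avoids_cuts_in_slice:
  assumes "P \<in> divisions d a" "t < d" "a t \<ge> 1" "0 \<le> u" "v \<le> 1"
    and avoid: "\<And>k. k \<in> {1..<a t} \<Longrightarrow> cut_point P t k \<notin> {u<..<v}"
  shows "\<exists>k<a t. cut_point P t k \<le> u \<and> v \<le> cut_point P t (Suc k)"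
proof -
  \<comment> \<open>Slices of length zero make cut points coincide; the largest index skips
    them.\<close>
  define k where "k = Max {k. k < a t \<and> cut_point P t k \<le> u}"
  have fin: "finite {k. k < a t \<and> cut_point P t k \<le> u}"
    by simp
  have "0 \<in> {k. k < a t \<and> cut_point P t k \<le> u}"
    using assms by simp
  with fin have k: "k < a t" "cut_point P t k \<le> u"
    unfolding k_def using Max_in[OF fin] by blast+
  have "v \<le> cut_point P t (Suc k)"
  proof (cases "Suc k = a t")
    case True
    then show ?thesis
      using cut_point_last[OF assms(1-3)] \<open>v \<le> 1\<close> by simp
  next
    case False
    with k have "Suc k < a t"
      by simp
    moreover have "\<not> cut_point P t (Suc k) \<le> u"
      using Max_ge[OF fin, of "Suc k"] \<open>Suc k < a t\<close> unfolding k_def[symmetric] by auto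
    ultimately show ?thesis
      using avoid[of "Suc k"] by auto
  qed
  with k show ?thesis
    by blast
qed

text \<open>Used for padding: \<open>coverable\<close> asks for exactly \<open>a t - 1\<close>
  points, but coinciding cuts may give fewer.\<close>

lemma superset_with_card:
  assumes "infinite B" "A \<subseteq> B" "finite A" "card A \<le> k"
  shows "\<exists>X. A \<subseteq> X \<and> X \<subseteq> B \<and> finite X \<and> card X = k"
proof -
  have "infinite (B - A)"
    using assms by simp
  then obtain Y where Y: "finite Y" "card Y = k - card A" "Y \<subseteq> B - A"
    using infinite_arbitrarily_large by blast
  then have "card (A \<union> Y) = k"
    using assms by (subst card_Un_disjoint) auto
  with Y assms show ?thesis
    by (intro exI[of _ "A \<union> Y"]) auto
qed

text \<open>The cuts of \<open>P\<close>, padded to the required number of points on each cake,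
  cannot cover \<open>\<F>\<close>. A member missed by the padded set is missed by the cuts.\<close>

lemma not_coverable_avoids_cuts:
  assumes P: "P \<in> divisions d a" and a: "\<And>t. t < d \<Longrightarrow> a t \<ge> 1" and "\<not> coverable d a \<F>"
  obtains f where "f \<in> \<F>" "\<And>t k. t < d \<Longrightarrow> k \<in> {1..<a t} \<Longrightarrow> (t, cut_point P t k) \<notin> f"
proof -
  let ?C = "\<lambda>t. cut_point P t ` {1..<a t}"
  have "\<exists>X. ?C t \<subseteq> X \<and> X \<subseteq> {0..1} \<and> finite X \<and> card X = a t - 1" if "t < d" for t
  proof (rule superset_with_card)
    show "?C t \<subseteq> {0..1}"
    proof (rule image_subsetI)
      fix k
      assume "k \<in> {1..<a t}"
      then show "cut_point P t k \<in> {0..1}"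
        using cut_point_mono[OF P that, of 0 k] cut_point_mono[OF P that, of k "a t"]
          cut_point_last[OF P that a[OF that]] by simp
    qed
    show "card (?C t) \<le> a t - 1"
      using card_image_le[of "{1..<a t}" "cut_point P t"] by simp
  qed (auto simp: infinite_Icc)
  then obtain X where X: "\<And>t. t < d \<Longrightarrow> ?C t \<subseteq> X t \<and> X t \<subseteq> {0..1} \<and> finite (X t) \<and> card (X t) = a t - 1"
    by metis
  then have "\<forall>t<d. X t \<subseteq> {0..1} \<and> finite (X t) \<and> card (X t) = a t - 1"
    by simp
  with \<open>\<not> coverable d a \<F>\<close> have "\<not> (\<forall>f\<in>\<F>. f \<inter> (SIGMA t:{..<d}. X t) \<noteq> {})"
    unfolding coverable_def by metis
  then obtain f where f: "f \<in> \<F>" "f \<inter> (SIGMA t:{..<d}. X t) = {}"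
    by blast
  have "(t, cut_point P t k) \<notin> f" if "t < d" "k \<in> {1..<a t}" for t k
  proof -
    have "cut_point P t k \<in> X t"
      using X[OF that(1)] that(2) by blast
    with f(2) that(1) show ?thesis
      by blast
  qed
  with f(1) show thesis
    by (rule that)
qed

lemma preference_interval_preference:
  assumes a: "\<And>t. t < d \<Longrightarrow> a t \<ge> 1" and "finite \<F>" and di: "\<And>f. f \<in> \<F> \<Longrightarrow> d_interval d f"
    and nc: "\<not> coverable d a \<F>"
  shows "preference d a (interval_preference d a \<F>)"
  unfolding preference_def
proof (intro conjI ballI)
  fix P
  show "interval_preference d a \<F> P \<subseteq> slice_tuples d a"
    by (auto simp: interval_preference_def)
next
  fix j
  assume "j \<in> slice_tuples d a"
  then have "{P \<in> divisions d a. j \<in> interval_preference d a \<F> P} =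
      (\<Union>f\<in>\<F>. {P \<in> divisions d a. f \<subseteq> slice_box d P j})"
    by (auto simp: interval_preference_def)
  then show "closedin (top_of_set (divisions d a)) {P \<in> divisions d a. j \<in> interval_preference d a \<F> P}"
    using \<open>finite \<F>\<close> di by (auto intro!: closedin_Union closedin_subset_slice_box)
next
  fix P
  assume P: "P \<in> divisions d a"
  obtain f where "f \<in> \<F>" and avoid: "\<And>t k. t < d \<Longrightarrow> k \<in> {1..<a t} \<Longrightarrow> (t, cut_point P t k) \<notin> f"
    using not_coverable_avoids_cuts[OF P a nc] by blast
  from di[OF \<open>f \<in> \<F>\<close>] obtain u v where uv: "\<And>t. t < d \<Longrightarrow> 0 \<le> u t \<and> u t < v t \<and> v t \<le> 1"
    and f: "f = (SIGMA t:{..<d}. {u t<..<v t})"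
    unfolding d_interval_def by blast
  have "\<exists>k<a t. cut_point P t k \<le> u t \<and> v t \<le> cut_point P t (Suc k)" if "t < d" for t
    using avoids_cuts_in_slice[OF P that a[OF that]] uv[OF that] avoid[OF that] that
    by (auto simp: f)
  then obtain k where k: "\<And>t. t < d \<Longrightarrow> k t < a t \<and> cut_point P t (k t) \<le> u t \<and> v t \<le> cut_point P t (Suc (k t))"
    by metis
  \<comment> \<open>Members of \<open>slice_tuples\<close> are extensional, so values at indices
    from \<open>d\<close> on must be \<open>undefined\<close>.\<close>
  define j where "j = restrict k {..<d}"
  have "j \<in> slice_tuples d a"
    using k by (auto simp: j_def slice_tuples_def)
  moreover have "f \<subseteq> slice_box d P j"
    unfolding f using uv k by (subst Sigma_subset_slice_box_iff) (auto simp: j_def)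
  ultimately have "j \<in> interval_preference d a \<F> P"
    using \<open>f \<in> \<F>\<close> by (auto simp: interval_preference_def)
  \<comment> \<open>The chosen slice has length at least \<open>v t - u t\<close>.\<close>
  moreover have "P t (j t) > 0" if "t < d" for t
    using k[OF that] uv[OF that] that by (simp add: j_def cut_point_Suc)
  ultimately show "\<exists>j\<in>interval_preference d a \<F> P. \<forall>t<d. P t (j t) > 0"
    by blast
qed

text \<open>The sizes are those of subsets of \<open>{..<n}\<close>, and the empty assignment is
  admissible, so \<open>Max\<close> ranges over a finite nonempty set.\<close>

lemma nu_D_attained:
  obtains Q \<phi> where "admissible_assignment d a n L P Q \<phi>" "card Q = nu_D d a n L P"
proof -
  let ?S = "{card Q | Q. \<exists>\<phi>. admissible_assignment d a n L P Q \<phi>}"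
  have "?S \<subseteq> card ` Pow {..<n}"
    by (auto simp: admissible_assignment_def)
  then have "finite ?S"
    by (rule finite_subset) simp
  moreover have "admissible_assignment d a n L P {} \<phi>" for \<phi>
    by (simp add: admissible_assignment_def)
  then have "?S \<noteq> {}"
    by blast
  ultimately have "Max ?S \<in> ?S"
    by (rule Max_in)
  then obtain Q \<phi> where "admissible_assignment d a n L P Q \<phi>" "Max ?S = card Q"
    by blast
  then show thesis
    by (intro that) (simp_all add: nu_D_def)
qed

text \<open>Each agent picks a member of its family inside the box assigned to it; disjointness
  passes from the boxes to these members.\<close>

lemma admissible_assignment_rainbow_matching:
  assumes P: "P \<in> divisions d a"
    and adm: "admissible_assignment d a n (\<lambda>i. interval_preference d a (\<F> i)) P Q \<phi>"
  shows "\<exists>f. rainbow_matching n \<F> Q f"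
proof -
  have "\<forall>q\<in>Q. \<exists>f\<in>\<F> q. f \<subseteq> slice_box d P (\<phi> q)"
    using adm by (auto simp: admissible_assignment_def interval_preference_def)
  then obtain f where f: "\<And>q. q \<in> Q \<Longrightarrow> f q \<in> \<F> q \<and> f q \<subseteq> slice_box d P (\<phi> q)"
    by metis
  have "disjnt (f q) (f q')" if "q \<in> Q" "q' \<in> Q" "q \<noteq> q'" for q q'
  proof -
    have "disjnt (slice_box d P (\<phi> q)) (slice_box d P (\<phi> q'))"
      using adm that by (intro disjnt_slice_box[OF P]) (auto simp: admissible_assignment_def)
    with f[OF that(1)] f[OF that(2)] show ?thesis
      by (meson disjnt_subset1 disjnt_subset2)
  qed
  with f adm show ?thesis
    unfolding rainbow_matching_def admissible_assignment_def by blast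
qed

theorem theorem7p4:
  fixes d n m :: nat and a :: "nat \<Rightarrow> nat"
  assumes "d \<ge> 1" and "n \<ge> 1" and "m \<ge> 1" and "\<forall>t<d. a t \<ge> 1"
    and "ad_arrow n d a m"
  shows "im_arrow n d a m"
  unfolding im_arrow_def
proof (intro allI impI)
  fix \<F> :: "nat \<Rightarrow> (nat \<times> real) set set"
  assume \<F>: "\<forall>i<n. finite (\<F> i) \<and> (\<forall>f\<in>\<F> i. d_interval d f) \<and> \<not> coverable d a (\<F> i)"
  define L where "L = (\<lambda>i. interval_preference d a (\<F> i))"
  have "\<forall>i<n. preference d a (L i)"
    unfolding L_def using \<F> assms(4) by (auto intro!: preference_interval_preference)
  with assms(5) obtain P where P: "P \<in> divisions d a" and "m \<le> nu_D d a n L P"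
    unfolding ad_arrow_def by blast
  then obtain Q \<phi> where adm: "admissible_assignment d a n L P Q \<phi>" and "m \<le> card Q"
    using nu_D_attained[of d a n L P] by metis
  \<comment> \<open>A matching of size exactly \<open>m\<close> is wanted; dropping agents keeps it
    rainbow and disjoint.\<close>
  then obtain Q' where Q': "Q' \<subseteq> Q" "card Q' = m"
    by (meson obtain_subset_with_card_n)
  obtain f where "rainbow_matching n \<F> Q f"
    using admissible_assignment_rainbow_matching[OF P] adm unfolding L_def by blast
  then have "rainbow_matching n \<F> Q' f"
    using Q' unfolding rainbow_matching_def by blast
  with Q' show "\<exists>Q f. rainbow_matching n \<F> Q f \<and> card Q = m"
    by blast
qed

end
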